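(* Let $\mathbb{P}$ be the set of all process terms. Let $$\mathfrak{U} = \{P \in \mathbb{P} \mid \exists\, \Gamma, \Delta, \Lambda \text{ such that } \Gamma; \Delta \vdash P :: \Lambda\}$$ be the set of processes typable in the two-sided type system $\pi\mathsf{ULL}$, and let $$\mathfrak{C} = \{P \in \mathbb{P} \mid \exists\, \Gamma, \Delta \text{ such that } P \vdash_{\mathsf{CLL}} \Gamma; \Delta\}$$ be the set of processes typable in the one-sided classical type system $\pi\mathsf{CLL}^{\mathsf{CP}}$. Then $\mathfrak{U} = \mathfrak{C}$.
   Context: **Types.** $A,B ::= \mathbf{1} \mid \bot \mid A \otimes B \mid A ⅋ B \mid A \multimap B \mid\ !A \mid\ ?A$ (no atoms). Duality: $\mathbf{1}^\perp=\bot$, $\bot^\perp=\mathbf{1}$, $(A\otimes B)^\perp = A^\perp ⅋ B^\perp$, $(A ⅋ B)^\perp = A^\perp\otimes B^\perp$, $(!A)^\perp = {?}A^\perp$, $(?A)^\perp = {!}A^\perp$. By decree $A\multimap B = A^\perp ⅋ B$ (these are identified). Duality is an involution. **Processes.** $P,Q ::= \mathbf{0} \mid [x\leftrightarrow y] \mid (\nu x)P \mid P|Q \mid x\langle y\rangle.P \mid x(y).P \mid\ !x(y).P \mid x\langle\rangle.\mathbf{0} \mid x().P$. The constructs $(\nu x)P$, $z(x).P$, $!z(x).P$ bind $x$ in $P$; the output $x\langle y\rangle.P$ binds nothing. $P\{y/x\}$ is capture-avoiding substitution of $y$ for free $x$. Terms are taken up to $\alpha$-conversion. **Contexts.** $\Gamma,\Delta,\Lambda$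 are finite unordered collections of assignments $x:A$ with pairwise distinct names; a comma denotes disjoint union, $\cdot$ is empty. $\Gamma$ is unrestricted, the others are linear. **System $\pi\mathsf{ULL}$** (judgments $\Gamma;\Delta\vdash P::\Lambda$; premises $\Rightarrow$ conclusion; primed contexts are arbitrary): - Id R: $\Gamma; x:A \vdash [x\leftrightarrow y] :: y:A$. - Id L: $\Gamma; x:A, y:A^\perp \vdash [x\leftrightarrow y] :: \cdot$. - Cut R: $\Gamma;\Delta\vdash P::\Lambda,x:A$ and $\Gamma;\Delta',x:A\vdash Q::\Lambda'$ $\Rightarrow$ $\Gamma;\Delta,\Delta'\vdash(\nu x)(P|Q)::\Lambda,\Lambda'$. - Cut L: $\Gamma;\Delta,x:A\vdash P::\Lambda$ and $\Gamma;\Delta',x:A^\perp\vdash Q::\Lambda'$ $\Rightarrow$ $\Gamma;\Delta,\Delta'\vdash(\nu x)(P|Q)::\Lambda,\Lambda'$. - Cut! R: $\Gamma;\cdot\vdash P::y:A$ and $\Gamma,u:A;\Delta\vdash Q::\Lambda$ $\Rightarrow$ $\Gamma;\Delta\vdash(\nu u)(!u(y).P\,|\,Q)::\Lambda$. - Cut! L: $\Gamma;y:A^\perp\vdash P::\cdot$ and $\Gamma,u:A;\Delta\vdash Q::\Lambda$ $\Rightarrow$ $\Gamma;\Delta\vdash(\nu u)(!u(y).P\,|\,Q)::\Lambda$. - Copy L: $\Gamma,u:A;\Delta,y:A\vdash P::\Lambda$ $\Rightarrow$ $\Gamma,u:A;\Delta\vdash(\nu y)u\langle y\rangle.P::\Lambda$.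 - Copy R: $\Gamma,u:A;\Delta\vdash P::\Lambda,y:A^\perp$ $\Rightarrow$ $\Gamma,u:A;\Delta\vdash(\nu y)u\langle y\rangle.P::\Lambda$. - $\mathbf 1$R: $\Gamma;\cdot\vdash x\langle\rangle.\mathbf 0::x:\mathbf 1$. - $\mathbf 1$L: $\Gamma;\Delta\vdash P::\Lambda$ $\Rightarrow$ $\Gamma;\Delta,x:\mathbf 1\vdash x().P::\Lambda$. - $\bot$R: $\Gamma;\Delta\vdash P::\Lambda$ $\Rightarrow$ $\Gamma;\Delta\vdash x().P::\Lambda,x:\bot$. - $\bot$L: $\Gamma;x:\bot\vdash x\langle\rangle.\mathbf 0::\cdot$. - $\otimes$R: $\Gamma;\Delta\vdash P::\Lambda,y:A$ and $\Gamma;\Delta'\vdash Q::\Lambda',x:B$ $\Rightarrow$ $\Gamma;\Delta,\Delta'\vdash(\nu y)x\langle y\rangle.(P|Q)::\Lambda,\Lambda',x:A\otimes B$. - $\otimes$L: $\Gamma;\Delta,y:A,x:B\vdash P::\Lambda$ $\Rightarrow$ $\Gamma;\Delta,x:A\otimes B\vdash x(y).P::\Lambda$. - $⅋$R: $\Gamma;\Delta\vdash P::\Lambda,y:A,x:B$ $\Rightarrow$ $\Gamma;\Delta\vdash x(y).P::\Lambda,x:A⅋B$. - $⅋$L: $\Gamma;\Delta,y:A\vdash P::\Lambda$ and $\Gamma;\Delta',x:B\vdash Q::\Lambda'$ $\Rightarrow$ $\Gamma;\Delta,\Delta',x:A⅋B\vdash(\nu y)x\langle y\rangle.(P|Q)::\Lambda,\Lambda'$.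 - $\multimap$R: $\Gamma;\Delta,y:A\vdash P::\Lambda,x:B$ $\Rightarrow$ $\Gamma;\Delta\vdash x(y).P::\Lambda,x:A\multimap B$. - $\multimap$L: $\Gamma;\Delta\vdash P::\Lambda,y:A$ and $\Gamma;\Delta',x:B\vdash Q::\Lambda'$ $\Rightarrow$ $\Gamma;\Delta,\Delta',x:A\multimap B\vdash(\nu y)x\langle y\rangle.(P|Q)::\Lambda,\Lambda'$. - $!$R: $\Gamma;\cdot\vdash P::y:A$ $\Rightarrow$ $\Gamma;\cdot\vdash\ !x(y).P::x:{!}A$. - $!$L: $\Gamma,u:A;\Delta\vdash P::\Lambda$ $\Rightarrow$ $\Gamma;\Delta,x:{!}A\vdash P\{x/u\}::\Lambda$. - $?$R: $\Gamma,u:A;\Delta\vdash P::\Lambda$ $\Rightarrow$ $\Gamma;\Delta\vdash P\{x/u\}::\Lambda,x:{?}A^\perp$. - $?$L: $\Gamma;y:A\vdash P::\cdot$ $\Rightarrow$ $\Gamma;x:{?}A\vdash\ !x(y).P::\cdot$. **System $\pi\mathsf{CLL}^{\mathsf{CP}}$** (judgments $P\vdash_{\mathsf{CLL}}\Gamma;\Delta$, with $\Gamma$ unrestricted and $\Delta$ linear; write $\vdash$ for $\vdash_{\mathsf{CLL}}$): - Id: $[x\leftrightarrow y]\vdash\Gamma;x:A,y:A^\perp$. - Cut: $P\vdash\Gamma;\Delta,x:A$ and $Q\vdash\Gamma;\Delta',x:A^\perp$ $\Rightarrow$ $(\nu x)(P|Q)\vdash\Gamma;\Delta,\Delta'$.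 - Cut!: $P\vdash\Gamma;y:A$ and $Q\vdash\Gamma,u:A^\perp;\Delta$ $\Rightarrow$ $(\nu u)(!u(y).P\,|\,Q)\vdash\Gamma;\Delta$. - Copy: $P\vdash\Gamma,u:A;\Delta,y:A$ $\Rightarrow$ $(\nu y)u\langle y\rangle.P\vdash\Gamma,u:A;\Delta$. - $\mathbf 1$: $x\langle\rangle.\mathbf 0\vdash\Gamma;x:\mathbf 1$. - $\bot$: $P\vdash\Gamma;\Delta$ $\Rightarrow$ $x().P\vdash\Gamma;\Delta,x:\bot$. - $\otimes$: $P\vdash\Gamma;\Delta,y:A$ and $Q\vdash\Gamma;\Delta',x:B$ $\Rightarrow$ $(\nu y)x\langle y\rangle.(P|Q)\vdash\Gamma;\Delta,\Delta',x:A\otimes B$. - $⅋$: $P\vdash\Gamma;\Delta,y:A,x:B$ $\Rightarrow$ $x(y).P\vdash\Gamma;\Delta,x:A⅋B$. - $!$: $P\vdash\Gamma;y:A$ $\Rightarrow$ $!x(y).P\vdash\Gamma;x:{!}A$. - $?$: $P\vdash\Gamma,u:A;\Delta$ $\Rightarrow$ $P\{x/u\}\vdash\Gamma;\Delta,x:{?}A$. *)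

theory Defs
  imports "HOL-Library.Multiset"
begin

datatype ty =
    One (\<open>\<one>\<close>)
  | Bot (\<open>\<bottom>\<close>)
  | Tensor ty ty (infixr \<open>\<otimes>\<close> 75)
  | Parr ty ty (infixr \<open>\<oslash>\<close> 75)
  | OfCourse ty (\<open>\<^bold>!_\<close> [80] 80)
  | WhyNot ty (\<open>\<^bold>?_\<close> [80] 80)

text \<open>\<open>A \<oslash> B\<close> is the multiplicative disjunction (``par'') and \<open>\<^bold>?A\<close> is the ``why not'' exponential.\<close>

primrec dual :: "ty \<Rightarrow> ty" (\<open>_\<^sup>\<bottom>\<close> [1000] 1000) where
  "\<one>\<^sup>\<bottom> = \<bottom>"
| "\<bottom>\<^sup>\<bottom> = \<one>"
| "(A \<otimes> B)\<^sup>\<bottom> = A\<^sup>\<bottom> \<oslash> B\<^sup>\<bottom>"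
| "(A \<oslash> B)\<^sup>\<bottom> = A\<^sup>\<bottom> \<otimes> B\<^sup>\<bottom>"
| "(\<^bold>!A)\<^sup>\<bottom> = \<^bold>?(A\<^sup>\<bottom>)"
| "(\<^bold>?A)\<^sup>\<bottom> = \<^bold>!(A\<^sup>\<bottom>)"

text \<open>Linear implication is identified with \<open>A\<^sup>\<bottom> \<oslash> B\<close>, so it is not a constructor of its own: the
  implication-free types represent the types modulo this identification.\<close>

definition lolli :: "ty \<Rightarrow> ty \<Rightarrow> ty" (infixr \<open>\<multimap>\<close> 74) where
  "A \<multimap> B = A\<^sup>\<bottom> \<oslash> B"

lemma dual_dual [simp]: "A\<^sup>\<bottom>\<^sup>\<bottom> = A"
  by (induction A) auto

type_synonym name = nat

text \<open>In \<open>RRes x P\<close>, \<open>RIn z x P\<close> and \<open>RRep z x P\<close> the name \<open>x\<close> is bound in \<open>P\<close>; \<open>ROut x y P\<close>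
  binds nothing.\<close>

datatype rproc =
    RNil
  | RFwd name name
  | RRes name rproc
  | RPar rproc rproc
  | ROut name name rproc
  | RIn name name rproc
  | RRep name name rproc
  | RClose name
  | RWait name rproc

primrec rfn :: "rproc \<Rightarrow> name set" where
  "rfn RNil = {}"
| "rfn (RFwd x y) = {x, y}"
| "rfn (RRes x P) = rfn P - {x}"
| "rfn (RPar P Q) = rfn P \<union> rfn Q"
| "rfn (ROut x y P) = {x, y} \<union> rfn P"
| "rfn (RIn z x P) = {z} \<union> (rfn P - {x})"
| "rfn (RRep z x P) = {z} \<union> (rfn P - {x})"
| "rfn (RClose x) = {x}"
| "rfn (RWait x P) = {x} \<union> rfn P"

definition fresh :: "name set \<Rightarrow> name" where
  "fresh N = (LEAST z. z \<notin> N)"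

text \<open>Simultaneous capture-avoiding renaming of the free names by \<open>\<sigma>\<close>: every binder is renamed to a
  name outside the renamed free names of the abstraction. Structural recursion is possible because
  the renaming of the binder is absorbed into \<open>\<sigma>\<close>.\<close>

primrec rren :: "(name \<Rightarrow> name) \<Rightarrow> rproc \<Rightarrow> rproc" where
  "rren \<sigma> RNil = RNil"
| "rren \<sigma> (RFwd x y) = RFwd (\<sigma> x) (\<sigma> y)"
| "rren \<sigma> (RRes x P) =
     (let x' = fresh (\<sigma> ` (rfn P - {x})) in RRes x' (rren (\<sigma>(x := x')) P))"
| "rren \<sigma> (RPar P Q) = RPar (rren \<sigma> P) (rren \<sigma> Q)"
| "rren \<sigma> (ROut x y P) = ROut (\<sigma> x) (\<sigma> y) (rren \<sigma> P)"
| "rren \<sigma> (RIn z x P) =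
     (let x' = fresh (\<sigma> ` (rfn P - {x})) in RIn (\<sigma> z) x' (rren (\<sigma>(x := x')) P))"
| "rren \<sigma> (RRep z x P) =
     (let x' = fresh (\<sigma> ` (rfn P - {x})) in RRep (\<sigma> z) x' (rren (\<sigma>(x := x')) P))"
| "rren \<sigma> (RClose x) = RClose (\<sigma> x)"
| "rren \<sigma> (RWait x P) = RWait (\<sigma> x) (rren \<sigma> P)"

definition rsubst :: "rproc \<Rightarrow> name \<Rightarrow> name \<Rightarrow> rproc" (\<open>_\<lbrace>_'/_\<rbrace>\<close> [1000, 0, 0] 1000) where
  "P\<lbrace>y/x\<rbrace> = rren (id(x := y)) P"

inductive alpha :: "rproc \<Rightarrow> rproc \<Rightarrow> bool" (infix \<open>\<approx>\<^sub>\<alpha>\<close> 50) where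
  alpha_refl: "P \<approx>\<^sub>\<alpha> P"
| alpha_sym: "P \<approx>\<^sub>\<alpha> Q \<Longrightarrow> Q \<approx>\<^sub>\<alpha> P"
| alpha_trans: "P \<approx>\<^sub>\<alpha> Q \<Longrightarrow> Q \<approx>\<^sub>\<alpha> R \<Longrightarrow> P \<approx>\<^sub>\<alpha> R"
| alpha_RRes: "y \<notin> rfn P \<Longrightarrow> RRes x P \<approx>\<^sub>\<alpha> RRes y (P\<lbrace>y/x\<rbrace>)"
| alpha_RIn: "y \<notin> rfn P \<Longrightarrow> RIn z x P \<approx>\<^sub>\<alpha> RIn z y (P\<lbrace>y/x\<rbrace>)"
| alpha_RRep: "y \<notin> rfn P \<Longrightarrow> RRep z x P \<approx>\<^sub>\<alpha> RRep z y (P\<lbrace>y/x\<rbrace>)"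
| cong_RRes: "P \<approx>\<^sub>\<alpha> Q \<Longrightarrow> RRes x P \<approx>\<^sub>\<alpha> RRes x Q"
| cong_RPar: "P \<approx>\<^sub>\<alpha> P' \<Longrightarrow> Q \<approx>\<^sub>\<alpha> Q' \<Longrightarrow> RPar P Q \<approx>\<^sub>\<alpha> RPar P' Q'"
| cong_ROut: "P \<approx>\<^sub>\<alpha> Q \<Longrightarrow> ROut x y P \<approx>\<^sub>\<alpha> ROut x y Q"
| cong_RIn: "P \<approx>\<^sub>\<alpha> Q \<Longrightarrow> RIn z x P \<approx>\<^sub>\<alpha> RIn z x Q"
| cong_RRep: "P \<approx>\<^sub>\<alpha> Q \<Longrightarrow> RRep z x P \<approx>\<^sub>\<alpha> RRep z x Q"
| cong_RWait: "P \<approx>\<^sub>\<alpha> Q \<Longrightarrow> RWait x P \<approx>\<^sub>\<alpha> RWait x Q"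

lemma finite_rfn [simp]: "finite (rfn P)"
  by (induction P) auto

lemma fresh_notin: "finite N \<Longrightarrow> fresh N \<notin> N"
  unfolding fresh_def using ex_new_if_finite[OF infinite_UNIV_nat, of N] by (metis LeastI)

lemma image_upd_Diff: "\<sigma>(x := x') ` N - {x'} = \<sigma> ` (N - {x})" if "x' \<notin> \<sigma> ` (N - {x})"
  using that by (auto simp: image_iff split: if_splits)

lemma fresh_image_notin: "fresh (\<sigma> ` (rfn P - {x})) \<notin> \<sigma> ` (rfn P - {x})"
  by (rule fresh_notin) simp

lemma rfn_rren [simp]: "rfn (rren \<sigma> P) = \<sigma> ` rfn P"
  by (induction P arbitrary: \<sigma>)
     (simp_all only: rren.simps rfn.simps Let_def image_upd_Diff[OF fresh_image_notin]
       image_Un image_insert image_empty)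

lemma rren_cong: "(\<And>z. z \<in> rfn P \<Longrightarrow> \<sigma> z = \<tau> z) \<Longrightarrow> rren \<sigma> P = rren \<tau> P"
proof (induction P arbitrary: \<sigma> \<tau>)
  case (RRes x P)
  have "\<sigma> ` (rfn P - {x}) = \<tau> ` (rfn P - {x})" using RRes.prems by (auto intro!: image_cong)
  then show ?case using RRes.prems by (auto simp: Let_def intro!: RRes.IH)
next
  case (RIn z x P)
  have "\<sigma> ` (rfn P - {x}) = \<tau> ` (rfn P - {x})" using RIn.prems by (auto intro!: image_cong)
  then show ?case using RIn.prems by (auto simp: Let_def intro!: RIn.IH)
next
  case (RRep z x P)
  have "\<sigma> ` (rfn P - {x}) = \<tau> ` (rfn P - {x})" using RRep.prems by (auto intro!: image_cong)
  then show ?case using RRep.prems by (auto simp: Let_def intro!: RRep.IH)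
next
  case (RPar P Q)
  have "rren \<sigma> P = rren \<tau> P" "rren \<sigma> Q = rren \<tau> Q"
    by (rule RPar.IH, simp add: RPar.prems)+
  then show ?case by simp
next
  case (ROut x y P)
  have "rren \<sigma> P = rren \<tau> P" by (rule ROut.IH) (simp add: ROut.prems)
  then show ?case using ROut.prems by simp
next
  case (RWait x P)
  have "rren \<sigma> P = rren \<tau> P" by (rule RWait.IH) (simp add: RWait.prems)
  then show ?case using RWait.prems by simp
qed auto

lemma rren_rren_binder:
  assumes IH: "\<And>\<sigma> \<tau>. rren \<sigma> (rren \<tau> P) = rren (\<sigma> \<circ> \<tau>) P"
    and x': "x' \<notin> \<tau> ` (rfn P - {x})"
  shows "\<sigma> ` (rfn (rren (\<tau>(x := x')) P) - {x'}) = (\<sigma> \<circ> \<tau>) ` (rfn P - {x})"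
    and "rren (\<sigma>(x' := x'')) (rren (\<tau>(x := x')) P) = rren ((\<sigma> \<circ> \<tau>)(x := x'')) P"
proof -
  show "\<sigma> ` (rfn (rren (\<tau>(x := x')) P) - {x'}) = (\<sigma> \<circ> \<tau>) ` (rfn P - {x})"
    using image_upd_Diff[OF x'] by (simp add: image_comp)
  have "rren (\<sigma>(x' := x'')) (rren (\<tau>(x := x')) P) = rren (\<sigma>(x' := x'') \<circ> \<tau>(x := x')) P"
    by (rule IH)
  also have "\<dots> = rren ((\<sigma> \<circ> \<tau>)(x := x'')) P"
    using x' by (intro rren_cong) (auto simp: image_iff)
  finally show "rren (\<sigma>(x' := x'')) (rren (\<tau>(x := x')) P) = rren ((\<sigma> \<circ> \<tau>)(x := x'')) P" .
qed

lemma rren_rren: "rren \<sigma> (rren \<tau> P) = rren (\<sigma> \<circ> \<tau>) P"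
proof (induction P arbitrary: \<sigma> \<tau>)
  case (RRes x P)
  show ?case
    by (simp only: rren.simps Let_def rren_rren_binder[OF RRes.IH fresh_image_notin])
next
  case (RIn z x P)
  show ?case
    by (simp only: rren.simps Let_def o_apply[of \<sigma> \<tau> z] rren_rren_binder[OF RIn.IH fresh_image_notin])
next
  case (RRep z x P)
  show ?case
    by (simp only: rren.simps Let_def o_apply[of \<sigma> \<tau> z] rren_rren_binder[OF RRep.IH fresh_image_notin])
qed simp_all

lemma rren_alpha_binder:
  assumes "y \<notin> rfn P"
  shows "\<sigma> ` (rfn (P\<lbrace>y/x\<rbrace>) - {y}) = \<sigma> ` (rfn P - {x})"
    and "rren (\<sigma>(y := x')) (P\<lbrace>y/x\<rbrace>) = rren (\<sigma>(x := x')) P"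
proof -
  have y: "y \<notin> id ` (rfn P - {x})" using assms by simp
  show "\<sigma> ` (rfn (P\<lbrace>y/x\<rbrace>) - {y}) = \<sigma> ` (rfn P - {x})"
    using rren_rren_binder(1)[OF rren_rren y, of \<sigma>] by (simp add: rsubst_def)
  show "rren (\<sigma>(y := x')) (P\<lbrace>y/x\<rbrace>) = rren (\<sigma>(x := x')) P"
    using rren_rren_binder(2)[OF rren_rren y, of \<sigma> x'] by (simp add: rsubst_def)
qed

lemma alpha_rfn: "P \<approx>\<^sub>\<alpha> Q \<Longrightarrow> rfn P = rfn Q"
proof (induction rule: alpha.induct)
  case (alpha_RRes y P x) show ?case using rren_alpha_binder(1)[OF alpha_RRes, of id] by simp
next
  case (alpha_RIn y P z x) show ?case using rren_alpha_binder(1)[OF alpha_RIn, of id] by simp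
next
  case (alpha_RRep y P z x) show ?case using rren_alpha_binder(1)[OF alpha_RRep, of id] by simp
qed auto

lemma alpha_rren: "P \<approx>\<^sub>\<alpha> Q \<Longrightarrow> rren \<sigma> P = rren \<sigma> Q"
  by (induction arbitrary: \<sigma> rule: alpha.induct)
     (simp_all add: Let_def rren_alpha_binder alpha_rfn)

quotient_type proc = rproc / alpha
  by (rule equivpI)
     (auto intro!: reflpI sympI transpI intro: alpha_refl alpha_sym alpha_trans)

lift_definition Nil :: proc (\<open>\<zero>\<close>) is RNil .

lift_definition Fwd :: "name \<Rightarrow> name \<Rightarrow> proc" (\<open>[_ \<leftrightarrow> _]\<close>) is RFwd .

lift_definition Res :: "name \<Rightarrow> proc \<Rightarrow> proc" (\<open>'(\<nu>_')_\<close> [0, 80] 80) is RRes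
  by (rule cong_RRes)

lift_definition Par :: "proc \<Rightarrow> proc \<Rightarrow> proc" (infixr \<open>\<parallel>\<close> 70) is RPar
  by (rule cong_RPar)

lift_definition Out :: "name \<Rightarrow> name \<Rightarrow> proc \<Rightarrow> proc" (\<open>_\<langle>_\<rangle>._\<close> [1000, 0, 80] 80) is ROut
  by (rule cong_ROut)

lift_definition In :: "name \<Rightarrow> name \<Rightarrow> proc \<Rightarrow> proc" (\<open>_\<lparr>_\<rparr>._\<close> [1000, 0, 80] 80) is RIn
  by (rule cong_RIn)

lift_definition Rep :: "name \<Rightarrow> name \<Rightarrow> proc \<Rightarrow> proc" (\<open>!_\<lparr>_\<rparr>._\<close> [1000, 0, 80] 80) is RRep
  by (rule cong_RRep)

lift_definition Close :: "name \<Rightarrow> proc" (\<open>_\<langle>\<rangle>.\<zero>\<close> [1000] 80) is RClose .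

lift_definition Wait :: "name \<Rightarrow> proc \<Rightarrow> proc" (\<open>_\<lparr>\<rparr>._\<close> [1000, 80] 80) is RWait
  by (rule cong_RWait)

lift_definition fn :: "proc \<Rightarrow> name set" is rfn
  by (rule alpha_rfn)

lift_definition subst :: "proc \<Rightarrow> name \<Rightarrow> name \<Rightarrow> proc" (\<open>_\<^bold>{_'/_}\<close> [1000, 0, 0] 1000) is rsubst
  by (simp add: rsubst_def alpha_rren alpha_refl)

text \<open>The equations below show that the renaming of every binder by \<open>rren\<close> is invisible on
  alpha-classes: substitution commutes with a binder whenever no capture is possible.\<close>

lemma alpha_Res: "y \<notin> fn P \<Longrightarrow> (\<nu>x)P = (\<nu>y)(P\<^bold>{y/x})"
  by transfer (rule alpha_RRes)

lemma alpha_In: "y \<notin> fn P \<Longrightarrow> z\<lparr>x\<rparr>.P = z\<lparr>y\<rparr>.(P\<^bold>{y/x})"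
  by transfer (rule alpha_RIn)

lemma alpha_Rep: "y \<notin> fn P \<Longrightarrow> !z\<lparr>x\<rparr>.P = !z\<lparr>y\<rparr>.(P\<^bold>{y/x})"
  by transfer (rule alpha_RRep)

lemma rsubst_binder:
  assumes "z \<noteq> x" "z \<noteq> y"
  shows "(RRes z P)\<lbrace>y/x\<rbrace> \<approx>\<^sub>\<alpha> RRes z (P\<lbrace>y/x\<rbrace>)"
    and "(RIn a z P)\<lbrace>y/x\<rbrace> \<approx>\<^sub>\<alpha> RIn (if a = x then y else a) z (P\<lbrace>y/x\<rbrace>)"
    and "(RRep a z P)\<lbrace>y/x\<rbrace> \<approx>\<^sub>\<alpha> RRep (if a = x then y else a) z (P\<lbrace>y/x\<rbrace>)"
proof -
  let ?\<sigma> = "id(x := y)"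
  define z' where "z' = fresh (?\<sigma> ` (rfn P - {z}))"
  define Q where "Q = rren (?\<sigma>(z := z')) P"
  have z': "z' \<notin> ?\<sigma> ` (rfn P - {z})" unfolding z'_def by (rule fresh_image_notin)
  have "?\<sigma> = ?\<sigma>(z := z)" using assms by auto
  then have P: "P\<lbrace>y/x\<rbrace> = rren (?\<sigma>(z := z)) P" by (simp add: rsubst_def)
  have zQ: "z \<notin> rfn Q" if "z \<noteq> z'"
    using that assms by (auto simp: Q_def)
  have Qz: "Q\<lbrace>z/z'\<rbrace> = P\<lbrace>y/x\<rbrace>"
    unfolding P Q_def rsubst_def rren_rren using z' assms by (intro rren_cong) (auto simp: image_iff)
  have eq: "Q = P\<lbrace>y/x\<rbrace>" if "z = z'"
    using that by (simp add: P Q_def)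
  have "RRes z' Q \<approx>\<^sub>\<alpha> RRes z (P\<lbrace>y/x\<rbrace>)"
    using alpha_RRes[OF zQ, of z'] Qz eq by (cases "z = z'") (simp_all add: alpha_refl)
  moreover have "RIn w z' Q \<approx>\<^sub>\<alpha> RIn w z (P\<lbrace>y/x\<rbrace>)" for w
    using alpha_RIn[OF zQ, of w z'] Qz eq by (cases "z = z'") (simp_all add: alpha_refl)
  moreover have "RRep w z' Q \<approx>\<^sub>\<alpha> RRep w z (P\<lbrace>y/x\<rbrace>)" for w
    using alpha_RRep[OF zQ, of w z'] Qz eq by (cases "z = z'") (simp_all add: alpha_refl)
  moreover have "?\<sigma> w = (if w = x then y else w)" for w
    by simp
  ultimately show "(RRes z P)\<lbrace>y/x\<rbrace> \<approx>\<^sub>\<alpha> RRes z (P\<lbrace>y/x\<rbrace>)"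
    and "(RIn a z P)\<lbrace>y/x\<rbrace> \<approx>\<^sub>\<alpha> RIn (if a = x then y else a) z (P\<lbrace>y/x\<rbrace>)"
    and "(RRep a z P)\<lbrace>y/x\<rbrace> \<approx>\<^sub>\<alpha> RRep (if a = x then y else a) z (P\<lbrace>y/x\<rbrace>)"
    by (simp_all only: rsubst_def[of "RRes z P"] rsubst_def[of "RIn a z P"]
      rsubst_def[of "RRep a z P"] rren.simps Let_def z'_def[symmetric] Q_def[symmetric])
qed

lemma subst_simps:
  "\<zero>\<^bold>{y/x} = \<zero>"
  "[a \<leftrightarrow> b]\<^bold>{y/x} = [(if a = x then y else a) \<leftrightarrow> (if b = x then y else b)]"
  "(P \<parallel> Q)\<^bold>{y/x} = P\<^bold>{y/x} \<parallel> Q\<^bold>{y/x}"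
  "(a\<langle>b\<rangle>.P)\<^bold>{y/x} = (if a = x then y else a)\<langle>(if b = x then y else b)\<rangle>.(P\<^bold>{y/x})"
  "(a\<langle>\<rangle>.\<zero>)\<^bold>{y/x} = (if a = x then y else a)\<langle>\<rangle>.\<zero>"
  "(a\<lparr>\<rparr>.P)\<^bold>{y/x} = (if a = x then y else a)\<lparr>\<rparr>.(P\<^bold>{y/x})"
  by (transfer, simp add: rsubst_def alpha_refl)+

lemma subst_Res: "z \<noteq> x \<Longrightarrow> z \<noteq> y \<Longrightarrow> ((\<nu>z)P)\<^bold>{y/x} = (\<nu>z)(P\<^bold>{y/x})"
  by transfer (rule rsubst_binder)

lemma subst_In:
  "z \<noteq> x \<Longrightarrow> z \<noteq> y \<Longrightarrow> (a\<lparr>z\<rparr>.P)\<^bold>{y/x} = (if a = x then y else a)\<lparr>z\<rparr>.(P\<^bold>{y/x})"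
  by transfer (rule rsubst_binder)

lemma subst_Rep:
  "z \<noteq> x \<Longrightarrow> z \<noteq> y \<Longrightarrow> (!a\<lparr>z\<rparr>.P)\<^bold>{y/x} = !(if a = x then y else a)\<lparr>z\<rparr>.(P\<^bold>{y/x})"
  by transfer (rule rsubst_binder)

text \<open>A context is a finite multiset of assignments and the comma is multiset union. The names of all
  contexts of a judgment are pairwise distinct; this is imposed by \<open>distinct_names\<close> on the conclusion
  of every rule, and so on every derivable judgment. Distinctness across the linear contexts matters:
  with \<open>x = y\<close> in rule \<open>IdR\<close>, \<open>[x \<leftrightarrow> x]\<close> would be typable in the two-sided system but not in the
  one-sided one.\<close>

type_synonym ctx = "(name \<times> ty) multiset"

definition names :: "ctx \<Rightarrow> name multiset" where
  "names \<Gamma> = image_mset fst \<Gamma>"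

definition distinct_names :: "ctx \<Rightarrow> bool" where
  "distinct_names \<Gamma> \<longleftrightarrow> (\<forall>x. count (names \<Gamma>) x \<le> 1)"

abbreviation (input) assign :: "name \<Rightarrow> ty \<Rightarrow> ctx" (infix \<open>\<^bold>:\<close> 68) where
  "x \<^bold>: A \<equiv> {#(x, A)#}"

text \<open>In the output rules for \<open>\<otimes>\<close>, \<open>\<oslash>\<close> and \<open>\<multimap>\<close>, the restriction on \<open>y\<close> also scopes over the
  subject \<open>x\<close> and over \<open>Q\<close>. By the usual convention that bound names differ from free ones, \<open>y\<close> is
  required to be distinct from \<open>x\<close> and from the names of the contexts of \<open>Q\<close>; for the other binders
  the distinctness of names already excludes capture.\<close>

inductive ULL :: "ctx \<Rightarrow> ctx \<Rightarrow> proc \<Rightarrow> ctx \<Rightarrow> bool"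
  (\<open>_\<^bold>; _ \<turnstile> _ \<Colon> _\<close> [61, 61, 61, 61] 60) where
  IdR: "distinct_names (\<Gamma> + x \<^bold>: A + y \<^bold>: A)
    \<Longrightarrow> \<Gamma>\<^bold>; x \<^bold>: A \<turnstile> [x \<leftrightarrow> y] \<Colon> y \<^bold>: A"
| IdL: "distinct_names (\<Gamma> + x \<^bold>: A + y \<^bold>: A\<^sup>\<bottom>)
    \<Longrightarrow> \<Gamma>\<^bold>; x \<^bold>: A + y \<^bold>: A\<^sup>\<bottom> \<turnstile> [x \<leftrightarrow> y] \<Colon> {#}"
| CutR: "\<lbrakk>\<Gamma>\<^bold>; \<Delta> \<turnstile> P \<Colon> \<Lambda> + x \<^bold>: A; \<Gamma>\<^bold>; \<Delta>' + x \<^bold>: A \<turnstile> Q \<Colon> \<Lambda>';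
      distinct_names (\<Gamma> + \<Delta> + \<Delta>' + \<Lambda> + \<Lambda>')\<rbrakk>
    \<Longrightarrow> \<Gamma>\<^bold>; \<Delta> + \<Delta>' \<turnstile> (\<nu>x)(P \<parallel> Q) \<Colon> \<Lambda> + \<Lambda>'"
| CutL: "\<lbrakk>\<Gamma>\<^bold>; \<Delta> + x \<^bold>: A \<turnstile> P \<Colon> \<Lambda>; \<Gamma>\<^bold>; \<Delta>' + x \<^bold>: A\<^sup>\<bottom> \<turnstile> Q \<Colon> \<Lambda>';
      distinct_names (\<Gamma> + \<Delta> + \<Delta>' + \<Lambda> + \<Lambda>')\<rbrakk>
    \<Longrightarrow> \<Gamma>\<^bold>; \<Delta> + \<Delta>' \<turnstile> (\<nu>x)(P \<parallel> Q) \<Colon> \<Lambda> + \<Lambda>'"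
| CutBangR: "\<lbrakk>\<Gamma>\<^bold>; {#} \<turnstile> P \<Colon> y \<^bold>: A; \<Gamma> + u \<^bold>: A\<^bold>; \<Delta> \<turnstile> Q \<Colon> \<Lambda>; distinct_names (\<Gamma> + \<Delta> + \<Lambda>)\<rbrakk>
    \<Longrightarrow> \<Gamma>\<^bold>; \<Delta> \<turnstile> (\<nu>u)(!u\<lparr>y\<rparr>.P \<parallel> Q) \<Colon> \<Lambda>"
| CutBangL: "\<lbrakk>\<Gamma>\<^bold>; y \<^bold>: A\<^sup>\<bottom> \<turnstile> P \<Colon> {#}; \<Gamma> + u \<^bold>: A\<^bold>; \<Delta> \<turnstile> Q \<Colon> \<Lambda>; distinct_names (\<Gamma> + \<Delta> + \<Lambda>)\<rbrakk>
    \<Longrightarrow> \<Gamma>\<^bold>; \<Delta> \<turnstile> (\<nu>u)(!u\<lparr>y\<rparr>.P \<parallel> Q) \<Colon> \<Lambda>"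
| CopyL: "\<lbrakk>\<Gamma> + u \<^bold>: A\<^bold>; \<Delta> + y \<^bold>: A \<turnstile> P \<Colon> \<Lambda>; distinct_names (\<Gamma> + u \<^bold>: A + \<Delta> + \<Lambda>)\<rbrakk>
    \<Longrightarrow> \<Gamma> + u \<^bold>: A\<^bold>; \<Delta> \<turnstile> (\<nu>y)u\<langle>y\<rangle>.P \<Colon> \<Lambda>"
| CopyR: "\<lbrakk>\<Gamma> + u \<^bold>: A\<^bold>; \<Delta> \<turnstile> P \<Colon> \<Lambda> + y \<^bold>: A\<^sup>\<bottom>; distinct_names (\<Gamma> + u \<^bold>: A + \<Delta> + \<Lambda>)\<rbrakk>
    \<Longrightarrow> \<Gamma> + u \<^bold>: A\<^bold>; \<Delta> \<turnstile> (\<nu>y)u\<langle>y\<rangle>.P \<Colon> \<Lambda>"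
| OneR: "distinct_names (\<Gamma> + x \<^bold>: \<one>)
    \<Longrightarrow> \<Gamma>\<^bold>; {#} \<turnstile> x\<langle>\<rangle>.\<zero> \<Colon> x \<^bold>: \<one>"
| OneL: "\<lbrakk>\<Gamma>\<^bold>; \<Delta> \<turnstile> P \<Colon> \<Lambda>; distinct_names (\<Gamma> + \<Delta> + x \<^bold>: \<one> + \<Lambda>)\<rbrakk>
    \<Longrightarrow> \<Gamma>\<^bold>; \<Delta> + x \<^bold>: \<one> \<turnstile> x\<lparr>\<rparr>.P \<Colon> \<Lambda>"
| BotR: "\<lbrakk>\<Gamma>\<^bold>; \<Delta> \<turnstile> P \<Colon> \<Lambda>; distinct_names (\<Gamma> + \<Delta> + \<Lambda> + x \<^bold>: \<bottom>)\<rbrakk>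
    \<Longrightarrow> \<Gamma>\<^bold>; \<Delta> \<turnstile> x\<lparr>\<rparr>.P \<Colon> \<Lambda> + x \<^bold>: \<bottom>"
| BotL: "distinct_names (\<Gamma> + x \<^bold>: \<bottom>)
    \<Longrightarrow> \<Gamma>\<^bold>; x \<^bold>: \<bottom> \<turnstile> x\<langle>\<rangle>.\<zero> \<Colon> {#}"
| TensorR: "\<lbrakk>\<Gamma>\<^bold>; \<Delta> \<turnstile> P \<Colon> \<Lambda> + y \<^bold>: A; \<Gamma>\<^bold>; \<Delta>' \<turnstile> Q \<Colon> \<Lambda>' + x \<^bold>: B;
      y \<notin># names (\<Delta>' + \<Lambda>' + x \<^bold>: B);
      distinct_names (\<Gamma> + \<Delta> + \<Delta>' + \<Lambda> + \<Lambda>' + x \<^bold>: A \<otimes> B)\<rbrakk>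
    \<Longrightarrow> \<Gamma>\<^bold>; \<Delta> + \<Delta>' \<turnstile> (\<nu>y)x\<langle>y\<rangle>.(P \<parallel> Q) \<Colon> \<Lambda> + \<Lambda>' + x \<^bold>: A \<otimes> B"
| TensorL: "\<lbrakk>\<Gamma>\<^bold>; \<Delta> + y \<^bold>: A + x \<^bold>: B \<turnstile> P \<Colon> \<Lambda>;
      distinct_names (\<Gamma> + \<Delta> + x \<^bold>: A \<otimes> B + \<Lambda>)\<rbrakk>
    \<Longrightarrow> \<Gamma>\<^bold>; \<Delta> + x \<^bold>: A \<otimes> B \<turnstile> x\<lparr>y\<rparr>.P \<Colon> \<Lambda>"
| ParrR: "\<lbrakk>\<Gamma>\<^bold>; \<Delta> \<turnstile> P \<Colon> \<Lambda> + y \<^bold>: A + x \<^bold>: B;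
      distinct_names (\<Gamma> + \<Delta> + \<Lambda> + x \<^bold>: A \<oslash> B)\<rbrakk>
    \<Longrightarrow> \<Gamma>\<^bold>; \<Delta> \<turnstile> x\<lparr>y\<rparr>.P \<Colon> \<Lambda> + x \<^bold>: A \<oslash> B"
| ParrL: "\<lbrakk>\<Gamma>\<^bold>; \<Delta> + y \<^bold>: A \<turnstile> P \<Colon> \<Lambda>; \<Gamma>\<^bold>; \<Delta>' + x \<^bold>: B \<turnstile> Q \<Colon> \<Lambda>';
      y \<notin># names (\<Delta>' + x \<^bold>: B + \<Lambda>');
      distinct_names (\<Gamma> + \<Delta> + \<Delta>' + x \<^bold>: A \<oslash> B + \<Lambda> + \<Lambda>')\<rbrakk>
    \<Longrightarrow> \<Gamma>\<^bold>; \<Delta> + \<Delta>' + x \<^bold>: A \<oslash> B \<turnstile> (\<nu>y)x\<langle>y\<rangle>.(P \<parallel> Q) \<Colon> \<Lambda> + \<Lambda>'"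
| LolliR: "\<lbrakk>\<Gamma>\<^bold>; \<Delta> + y \<^bold>: A \<turnstile> P \<Colon> \<Lambda> + x \<^bold>: B;
      distinct_names (\<Gamma> + \<Delta> + \<Lambda> + x \<^bold>: A \<multimap> B)\<rbrakk>
    \<Longrightarrow> \<Gamma>\<^bold>; \<Delta> \<turnstile> x\<lparr>y\<rparr>.P \<Colon> \<Lambda> + x \<^bold>: A \<multimap> B"
| LolliL: "\<lbrakk>\<Gamma>\<^bold>; \<Delta> \<turnstile> P \<Colon> \<Lambda> + y \<^bold>: A; \<Gamma>\<^bold>; \<Delta>' + x \<^bold>: B \<turnstile> Q \<Colon> \<Lambda>';
      y \<notin># names (\<Delta>' + x \<^bold>: B + \<Lambda>');
      distinct_names (\<Gamma> + \<Delta> + \<Delta>' + x \<^bold>: A \<multimap> B + \<Lambda> + \<Lambda>')\<rbrakk>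
    \<Longrightarrow> \<Gamma>\<^bold>; \<Delta> + \<Delta>' + x \<^bold>: A \<multimap> B \<turnstile> (\<nu>y)x\<langle>y\<rangle>.(P \<parallel> Q) \<Colon> \<Lambda> + \<Lambda>'"
| BangR: "\<lbrakk>\<Gamma>\<^bold>; {#} \<turnstile> P \<Colon> y \<^bold>: A; distinct_names (\<Gamma> + x \<^bold>: \<^bold>!A)\<rbrakk>
    \<Longrightarrow> \<Gamma>\<^bold>; {#} \<turnstile> !x\<lparr>y\<rparr>.P \<Colon> x \<^bold>: \<^bold>!A"
| BangL: "\<lbrakk>\<Gamma> + u \<^bold>: A\<^bold>; \<Delta> \<turnstile> P \<Colon> \<Lambda>; distinct_names (\<Gamma> + \<Delta> + x \<^bold>: \<^bold>!A + \<Lambda>)\<rbrakk>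
    \<Longrightarrow> \<Gamma>\<^bold>; \<Delta> + x \<^bold>: \<^bold>!A \<turnstile> P\<^bold>{x/u} \<Colon> \<Lambda>"
| WhyNotR: "\<lbrakk>\<Gamma> + u \<^bold>: A\<^bold>; \<Delta> \<turnstile> P \<Colon> \<Lambda>; distinct_names (\<Gamma> + \<Delta> + \<Lambda> + x \<^bold>: \<^bold>?(A\<^sup>\<bottom>))\<rbrakk>
    \<Longrightarrow> \<Gamma>\<^bold>; \<Delta> \<turnstile> P\<^bold>{x/u} \<Colon> \<Lambda> + x \<^bold>: \<^bold>?(A\<^sup>\<bottom>)"
| WhyNotL: "\<lbrakk>\<Gamma>\<^bold>; y \<^bold>: A \<turnstile> P \<Colon> {#}; distinct_names (\<Gamma> + x \<^bold>: \<^bold>?A)\<rbrakk>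
    \<Longrightarrow> \<Gamma>\<^bold>; x \<^bold>: \<^bold>?A \<turnstile> !x\<lparr>y\<rparr>.P \<Colon> {#}"

inductive CLL :: "proc \<Rightarrow> ctx \<Rightarrow> ctx \<Rightarrow> bool"
  (\<open>_ \<turnstile>\<^sub>C\<^sub>L\<^sub>L _\<^bold>; _\<close> [61, 61, 61] 60) where
  Id: "distinct_names (\<Gamma> + x \<^bold>: A + y \<^bold>: A\<^sup>\<bottom>)
    \<Longrightarrow> [x \<leftrightarrow> y] \<turnstile>\<^sub>C\<^sub>L\<^sub>L \<Gamma>\<^bold>; x \<^bold>: A + y \<^bold>: A\<^sup>\<bottom>"
| Cut: "\<lbrakk>P \<turnstile>\<^sub>C\<^sub>L\<^sub>L \<Gamma>\<^bold>; \<Delta> + x \<^bold>: A; Q \<turnstile>\<^sub>C\<^sub>L\<^sub>L \<Gamma>\<^bold>; \<Delta>' + x \<^bold>: A\<^sup>\<bottom>; distinct_names (\<Gamma> + \<Delta> + \<Delta>')\<rbrakk>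
    \<Longrightarrow> (\<nu>x)(P \<parallel> Q) \<turnstile>\<^sub>C\<^sub>L\<^sub>L \<Gamma>\<^bold>; \<Delta> + \<Delta>'"
| CutBang: "\<lbrakk>P \<turnstile>\<^sub>C\<^sub>L\<^sub>L \<Gamma>\<^bold>; y \<^bold>: A; Q \<turnstile>\<^sub>C\<^sub>L\<^sub>L \<Gamma> + u \<^bold>: A\<^sup>\<bottom>\<^bold>; \<Delta>; distinct_names (\<Gamma> + \<Delta>)\<rbrakk>
    \<Longrightarrow> (\<nu>u)(!u\<lparr>y\<rparr>.P \<parallel> Q) \<turnstile>\<^sub>C\<^sub>L\<^sub>L \<Gamma>\<^bold>; \<Delta>"
| Copy: "\<lbrakk>P \<turnstile>\<^sub>C\<^sub>L\<^sub>L \<Gamma> + u \<^bold>: A\<^bold>; \<Delta> + y \<^bold>: A; distinct_names (\<Gamma> + u \<^bold>: A + \<Delta>)\<rbrakk>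
    \<Longrightarrow> (\<nu>y)u\<langle>y\<rangle>.P \<turnstile>\<^sub>C\<^sub>L\<^sub>L \<Gamma> + u \<^bold>: A\<^bold>; \<Delta>"
| One: "distinct_names (\<Gamma> + x \<^bold>: \<one>)
    \<Longrightarrow> x\<langle>\<rangle>.\<zero> \<turnstile>\<^sub>C\<^sub>L\<^sub>L \<Gamma>\<^bold>; x \<^bold>: \<one>"
| Bot: "\<lbrakk>P \<turnstile>\<^sub>C\<^sub>L\<^sub>L \<Gamma>\<^bold>; \<Delta>; distinct_names (\<Gamma> + \<Delta> + x \<^bold>: \<bottom>)\<rbrakk>
    \<Longrightarrow> x\<lparr>\<rparr>.P \<turnstile>\<^sub>C\<^sub>L\<^sub>L \<Gamma>\<^bold>; \<Delta> + x \<^bold>: \<bottom>"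
| Tensor: "\<lbrakk>P \<turnstile>\<^sub>C\<^sub>L\<^sub>L \<Gamma>\<^bold>; \<Delta> + y \<^bold>: A; Q \<turnstile>\<^sub>C\<^sub>L\<^sub>L \<Gamma>\<^bold>; \<Delta>' + x \<^bold>: B; y \<notin># names (\<Delta>' + x \<^bold>: B);
      distinct_names (\<Gamma> + \<Delta> + \<Delta>' + x \<^bold>: A \<otimes> B)\<rbrakk>
    \<Longrightarrow> (\<nu>y)x\<langle>y\<rangle>.(P \<parallel> Q) \<turnstile>\<^sub>C\<^sub>L\<^sub>L \<Gamma>\<^bold>; \<Delta> + \<Delta>' + x \<^bold>: A \<otimes> B"
| Parr: "\<lbrakk>P \<turnstile>\<^sub>C\<^sub>L\<^sub>L \<Gamma>\<^bold>; \<Delta> + y \<^bold>: A + x \<^bold>: B; distinct_names (\<Gamma> + \<Delta> + x \<^bold>: A \<oslash> B)\<rbrakk>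
    \<Longrightarrow> x\<lparr>y\<rparr>.P \<turnstile>\<^sub>C\<^sub>L\<^sub>L \<Gamma>\<^bold>; \<Delta> + x \<^bold>: A \<oslash> B"
| Bang: "\<lbrakk>P \<turnstile>\<^sub>C\<^sub>L\<^sub>L \<Gamma>\<^bold>; y \<^bold>: A; distinct_names (\<Gamma> + x \<^bold>: \<^bold>!A)\<rbrakk>
    \<Longrightarrow> !x\<lparr>y\<rparr>.P \<turnstile>\<^sub>C\<^sub>L\<^sub>L \<Gamma>\<^bold>; x \<^bold>: \<^bold>!A"
| WhyNot: "\<lbrakk>P \<turnstile>\<^sub>C\<^sub>L\<^sub>L \<Gamma> + u \<^bold>: A\<^bold>; \<Delta>; distinct_names (\<Gamma> + \<Delta> + x \<^bold>: \<^bold>?A)\<rbrakk>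
    \<Longrightarrow> P\<^bold>{x/u} \<turnstile>\<^sub>C\<^sub>L\<^sub>L \<Gamma>\<^bold>; \<Delta> + x \<^bold>: \<^bold>?A"

definition ULL_processes :: "proc set" (\<open>\<UU>\<close>) where
  "\<UU> = {P. \<exists>\<Gamma> \<Delta> \<Lambda>. \<Gamma>\<^bold>; \<Delta> \<turnstile> P \<Colon> \<Lambda>}"

definition CLL_processes :: "proc set" (\<open>\<CC>\<close>) where
  "\<CC> = {P. \<exists>\<Gamma> \<Delta>. P \<turnstile>\<^sub>C\<^sub>L\<^sub>L \<Gamma>\<^bold>; \<Delta>}"

end

theory Submission
  imports Defs
begin

text \<open>Moving an assignment across the turnstile dualises its type. A two-sided derivation thus becomes
  a one-sided one rule by rule, once the unrestricted and the left context are dualised. Conversely,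
  the left rules of the two-sided system together with \<open>IdL\<close>, \<open>CutL\<close>, \<open>CutBangL\<close> and \<open>CopyL\<close> already
  mirror all rules of the one-sided system, so that a one-sided derivation is simulated with all
  assignments dualised and an empty right context. The process does not change in either direction.\<close>

definition dual_ctx :: "ctx \<Rightarrow> ctx" where
  "dual_ctx \<Gamma> = image_mset (map_prod id dual) \<Gamma>"

lemma dual_ctx_simps [simp]:
  "dual_ctx {#} = {#}"
  "dual_ctx (\<Gamma> + \<Delta>) = dual_ctx \<Gamma> + dual_ctx \<Delta>"
  "dual_ctx (add_mset (x, A) \<Gamma>) = add_mset (x, A\<^sup>\<bottom>) (dual_ctx \<Gamma>)"
  by (simp_all add: dual_ctx_def)

text \<open>The last equation is the key one: dualising a context keeps its names, so the
  distinctness and freshness conditions of a rule carry over to its translation.\<close>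

lemma names_simps [simp]:
  "names {#} = {#}"
  "names (\<Gamma> + \<Delta>) = names \<Gamma> + names \<Delta>"
  "names (add_mset (x, A) \<Gamma>) = add_mset x (names \<Gamma>)"
  "names (dual_ctx \<Gamma>) = names \<Gamma>"
  by (simp_all add: names_def dual_ctx_def multiset.map_comp comp_def)

text \<open>The unrestricted context has to be dualised too because it acts like a left context:
  \<open>CopyL\<close> draws \<open>y : A\<close> on the left, and \<open>CopyR\<close> draws the
  dual type on the right, from the same \<open>u : A\<close>.\<close>

lemma ULL_imp_CLL: "\<Gamma>\<^bold>; \<Delta> \<turnstile> P \<Colon> \<Lambda> \<Longrightarrow> P \<turnstile>\<^sub>C\<^sub>L\<^sub>L dual_ctx \<Gamma>\<^bold>; dual_ctx \<Delta> + \<Lambda>"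
proof (induction rule: ULL.induct)
  case (IdR \<Gamma> x A y)
  \<comment> \<open>\<open>x : A\<close> on the left becomes \<open>x : A\<^sup>\<bottom>\<close>,
    so \<open>Id\<close> is used at \<open>A\<^sup>\<bottom>\<close>, and \<open>dual_dual\<close>
    gives \<open>y\<close> the type \<open>A\<close>. In case \<open>IdL\<close> this is also the
    dual of the left assignment to \<open>y\<close>, so both cases share one instance.\<close>
  then show ?case using CLL.Id[of "dual_ctx \<Gamma>" x "A\<^sup>\<bottom>" y]
    by (simp add: distinct_names_def)
next
  case (IdL \<Gamma> x A y)
  then show ?case using CLL.Id[of "dual_ctx \<Gamma>" x "A\<^sup>\<bottom>" y]
    by (simp add: distinct_names_def)
next
  case (CutR \<Gamma> \<Delta> P \<Lambda> x A \<Delta>' Q \<Lambda>')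
  then show ?case using CLL.Cut[of P "dual_ctx \<Gamma>" "dual_ctx \<Delta> + \<Lambda>" x A Q "dual_ctx \<Delta>' + \<Lambda>'"]
    by (simp add: distinct_names_def ac_simps)
next
  case (CutL \<Gamma> \<Delta> x A P \<Lambda> \<Delta>' Q \<Lambda>')
  then show ?case using CLL.Cut[of P "dual_ctx \<Gamma>" "dual_ctx \<Delta> + \<Lambda>" x "A\<^sup>\<bottom>" Q "dual_ctx \<Delta>' + \<Lambda>'"]
    by (simp add: distinct_names_def ac_simps)
next
  case (CutBangR \<Gamma> P y A u \<Delta> Q \<Lambda>)
  \<comment> \<open>Dualising the unrestricted context turns \<open>u : A\<close> into exactly the
    assignment that \<open>CutBang\<close> at \<open>A\<close> expects.\<close>
  then show ?case using CLL.CutBang[of P "dual_ctx \<Gamma>" y A Q u "dual_ctx \<Delta> + \<Lambda>"]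
    by (simp add: distinct_names_def ac_simps)
next
  case (CutBangL \<Gamma> y A P u \<Delta> Q \<Lambda>)
  then show ?case using CLL.CutBang[of P "dual_ctx \<Gamma>" y A Q u "dual_ctx \<Delta> + \<Lambda>"]
    by (simp add: distinct_names_def ac_simps)
next
  case (CopyL \<Gamma> u A \<Delta> y P \<Lambda>)
  then show ?case using CLL.Copy[of P "dual_ctx \<Gamma>" u "A\<^sup>\<bottom>" "dual_ctx \<Delta> + \<Lambda>" y]
    by (simp add: distinct_names_def ac_simps)
next
  case (CopyR \<Gamma> u A \<Delta> P \<Lambda> y)
  then show ?case using CLL.Copy[of P "dual_ctx \<Gamma>" u "A\<^sup>\<bottom>" "dual_ctx \<Delta> + \<Lambda>" y]
    by (simp add: distinct_names_def ac_simps)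
next
  case (OneR \<Gamma> x)
  then show ?case using CLL.One[of "dual_ctx \<Gamma>" x]
    by (simp add: distinct_names_def ac_simps)
next
  case (OneL \<Gamma> \<Delta> P \<Lambda> x)
  then show ?case using CLL.Bot[of P "dual_ctx \<Gamma>" "dual_ctx \<Delta> + \<Lambda>" x]
    by (simp add: distinct_names_def ac_simps)
next
  case (BotR \<Gamma> \<Delta> P \<Lambda> x)
  then show ?case using CLL.Bot[of P "dual_ctx \<Gamma>" "dual_ctx \<Delta> + \<Lambda>" x]
    by (simp add: distinct_names_def ac_simps)
next
  case (BotL \<Gamma> x)
  then show ?case using CLL.One[of "dual_ctx \<Gamma>" x]
    by (simp add: distinct_names_def ac_simps)
next
  case (TensorR \<Gamma> \<Delta> P \<Lambda> y A \<Delta>' Q \<Lambda>' x B)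
  then show ?case
    using CLL.Tensor[of P "dual_ctx \<Gamma>" "dual_ctx \<Delta> + \<Lambda>" y A Q "dual_ctx \<Delta>' + \<Lambda>'" x B]
    by (simp add: distinct_names_def ac_simps)
next
  case (TensorL \<Gamma> \<Delta> y A x B P \<Lambda>)
  then show ?case using CLL.Parr[of P "dual_ctx \<Gamma>" "dual_ctx \<Delta> + \<Lambda>" y "A\<^sup>\<bottom>" x "B\<^sup>\<bottom>"]
    by (simp add: distinct_names_def ac_simps)
next
  case (ParrR \<Gamma> \<Delta> P \<Lambda> y A x B)
  then show ?case using CLL.Parr[of P "dual_ctx \<Gamma>" "dual_ctx \<Delta> + \<Lambda>" y A x B]
    by (simp add: distinct_names_def ac_simps)
next
  case (ParrL \<Gamma> \<Delta> y A P \<Lambda> \<Delta>' x B Q \<Lambda>')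
  then show ?case
    using CLL.Tensor[of P "dual_ctx \<Gamma>" "dual_ctx \<Delta> + \<Lambda>" y "A\<^sup>\<bottom>" Q "dual_ctx \<Delta>' + \<Lambda>'" x "B\<^sup>\<bottom>"]
    by (simp add: distinct_names_def ac_simps)
next
  case (LolliR \<Gamma> \<Delta> y A P \<Lambda> x B)
  \<comment> \<open>By \<open>lolli_def\<close> an implication on the right is a par whose first
    component is \<open>A\<^sup>\<bottom>\<close>, the type that \<open>y : A\<close> receives when
    it leaves the left context.\<close>
  then show ?case using CLL.Parr[of P "dual_ctx \<Gamma>" "dual_ctx \<Delta> + \<Lambda>" y "A\<^sup>\<bottom>" x B]
    by (simp add: distinct_names_def ac_simps lolli_def)
next
  case (LolliL \<Gamma> \<Delta> P \<Lambda> y A \<Delta>' x B Q \<Lambda>')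
  \<comment> \<open>On the left the implication dualises to
    \<open>A \<otimes> B\<^sup>\<bottom>\<close>. So \<open>y\<close> keeps its type and only
    \<open>x\<close> is dualised.\<close>
  then show ?case
    using CLL.Tensor[of P "dual_ctx \<Gamma>" "dual_ctx \<Delta> + \<Lambda>" y A Q "dual_ctx \<Delta>' + \<Lambda>'" x "B\<^sup>\<bottom>"]
    by (simp add: distinct_names_def ac_simps lolli_def)
next
  case (BangR \<Gamma> P y A x)
  then show ?case using CLL.Bang[of P "dual_ctx \<Gamma>" y A x]
    by (simp add: distinct_names_def ac_simps)
next
  case (BangL \<Gamma> u A \<Delta> P \<Lambda> x)
  then show ?case using CLL.WhyNot[of P "dual_ctx \<Gamma>" u "A\<^sup>\<bottom>" "dual_ctx \<Delta> + \<Lambda>" x]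
    by (simp add: distinct_names_def ac_simps)
next
  case (WhyNotR \<Gamma> u A \<Delta> P \<Lambda> x)
  then show ?case using CLL.WhyNot[of P "dual_ctx \<Gamma>" u "A\<^sup>\<bottom>" "dual_ctx \<Delta> + \<Lambda>" x]
    by (simp add: distinct_names_def ac_simps)
next
  case (WhyNotL \<Gamma> y A P x)
  then show ?case using CLL.Bang[of P "dual_ctx \<Gamma>" y "A\<^sup>\<bottom>" x]
    by (simp add: distinct_names_def ac_simps)
qed

text \<open>Moving the principal formula to the left exchanges connectives: \<open>Tensor\<close> is
  simulated by \<open>ParrL\<close>, \<open>Parr\<close> by \<open>TensorL\<close>,
  \<open>One\<close> by \<open>BotL\<close>, \<open>Bot\<close> by \<open>OneL\<close>,
  \<open>Bang\<close> by \<open>WhyNotL\<close> and \<open>WhyNot\<close> by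
  \<open>BangL\<close>.\<close>

lemma CLL_imp_ULL: "P \<turnstile>\<^sub>C\<^sub>L\<^sub>L \<Gamma>\<^bold>; \<Delta> \<Longrightarrow> dual_ctx \<Gamma>\<^bold>; dual_ctx \<Delta> \<turnstile> P \<Colon> {#}"
proof (induction rule: CLL.induct)
  case (Id \<Gamma> x A y)
  then show ?case using ULL.IdL[of "dual_ctx \<Gamma>" x "A\<^sup>\<bottom>" y]
    by (simp add: distinct_names_def)
next
  case (Cut P \<Gamma> \<Delta> x A Q \<Delta>')
  then show ?case
    using ULL.CutL[of "dual_ctx \<Gamma>" "dual_ctx \<Delta>" x "A\<^sup>\<bottom>" P "{#}" "dual_ctx \<Delta>'" Q "{#}"]
    by (simp add: distinct_names_def)
next
  case (CutBang P \<Gamma> y A Q u \<Delta>)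
  \<comment> \<open>\<open>CutBangL\<close> is taken at \<open>A\<close> itself: its first premise
    already carries the dual on \<open>y\<close>, and \<open>u : A\<^sup>\<bottom>\<close> dualises
    back to \<open>u : A\<close>.\<close>
  then show ?case using ULL.CutBangL[of "dual_ctx \<Gamma>" y A P u "dual_ctx \<Delta>" Q "{#}"]
    by (simp add: distinct_names_def)
next
  case (Copy P \<Gamma> u A \<Delta> y)
  then show ?case using ULL.CopyL[of "dual_ctx \<Gamma>" u "A\<^sup>\<bottom>" "dual_ctx \<Delta>" y P "{#}"]
    by (simp add: distinct_names_def)
next
  case (One \<Gamma> x)
  then show ?case using ULL.BotL[of "dual_ctx \<Gamma>" x]
    by (simp add: distinct_names_def)
next
  case (Bot P \<Gamma> \<Delta> x)
  then show ?case using ULL.OneL[of "dual_ctx \<Gamma>" "dual_ctx \<Delta>" P "{#}" x]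
    by (simp add: distinct_names_def)
next
  case (Tensor P \<Gamma> \<Delta> y A Q \<Delta>' x B)
  then show ?case
    using ULL.ParrL[of "dual_ctx \<Gamma>" "dual_ctx \<Delta>" y "A\<^sup>\<bottom>" P "{#}" "dual_ctx \<Delta>'" x "B\<^sup>\<bottom>" Q "{#}"]
    by (simp add: distinct_names_def)
next
  case (Parr P \<Gamma> \<Delta> y A x B)
  then show ?case
    using ULL.TensorL[of "dual_ctx \<Gamma>" "dual_ctx \<Delta>" y "A\<^sup>\<bottom>" x "B\<^sup>\<bottom>" P "{#}"]
    by (simp add: distinct_names_def)
next
  case (Bang P \<Gamma> y A x)
  then show ?case using ULL.WhyNotL[of "dual_ctx \<Gamma>" y "A\<^sup>\<bottom>" P x]
    by (simp add: distinct_names_def)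
next
  case (WhyNot P \<Gamma> u A \<Delta> x)
  then show ?case using ULL.BangL[of "dual_ctx \<Gamma>" u "A\<^sup>\<bottom>" "dual_ctx \<Delta>" P "{#}" x]
    by (simp add: distinct_names_def)
qed

theorem theorem3p2:
  shows "\<UU> = \<CC>"
  unfolding ULL_processes_def CLL_processes_def by (blast intro: ULL_imp_CLL CLL_imp_ULL)

end
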